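(* Let $a=(a_n)_{n\ge0}$ be a non-decreasing sequence of positive numbers. Then $a$ is log completely alternating if and only if the quotient sequence $b=(b_n)_{n\ge0}$, $b_n=\frac{a_n}{a_{n+1}}$, is log completely alternating.
   Context: A sequence $a=(a_j)_{j\ge0}$ of positive numbers is log completely alternating if $\sum_{i=0}^n(-1)^i\binom{n}{i}\ln a_{k+i}\le 0$ for all $n\ge 1$ and $k\ge 0$. *)

theory Defs
  imports Complex_Main
begin

definition log_completely_alternating :: "(nat \<Rightarrow> real) \<Rightarrow> bool" where
  "log_completely_alternating a \<longleftrightarrow>
     (\<forall>j. 0 < a j) \<and>
     (\<forall>n\<ge>1. \<forall>k. (\<Sum>i=0..n. (-1) ^ i * real (n choose i) * ln (a (k + i))) \<le> 0)"

end

theory Submission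
  imports Defs
begin

text \<open>
  The alternating sum in the definition is the \<open>n\<close>-th iterate of the negated difference
  \<open>f \<mapsto> (\<lambda>k. f k - f (k + 1))\<close> applied to \<open>f = ln \<circ> a\<close>. Since \<open>ln (a k / a (k + 1))\<close> is itself
  one such difference of \<open>f\<close>, the condition of order \<open>n\<close> for the quotients is the condition of
  order \<open>n + 1\<close> for \<open>a\<close> (lemma \<open>alternating_binomial_sum_Suc\<close>). The quotients thus satisfy all
  conditions exactly when \<open>a\<close> satisfies those of order at least two, and the one left over, of
  order one, is \<open>ln (a k) \<le> ln (a (k + 1))\<close>, which is monotonicity.
\<close>

text \<open>
  By Pascal's rule, one more order of differencing can be performed on the inside,
  that is, on \<open>f\<close> before the alternating sum is taken.
\<close>

lemma alternating_binomial_sum_Suc: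
  fixes f :: "nat \<Rightarrow> 'a::comm_ring_1"
  shows "(\<Sum>i=0..Suc n. (-1) ^ i * of_nat (Suc n choose i) * f i)
       = (\<Sum>i=0..n. (-1) ^ i * of_nat (n choose i) * (f i - f (Suc i)))"
proof -
  let ?t = "\<lambda>i. (-1) ^ i * of_nat (n choose i) * f i"
  have "(\<Sum>i=0..Suc n. (-1) ^ i * of_nat (Suc n choose i) * f i)
      = f 0 + (\<Sum>i=0..n. ?t (Suc i) - (-1) ^ i * of_nat (n choose i) * f (Suc i))"
    unfolding sum.atLeast0_atMost_Suc_shift
    by (intro arg_cong2[where f = "(+)"] sum.cong) (simp_all add: algebra_simps)
  also have "\<dots> = (f 0 + (\<Sum>i=0..n. ?t (Suc i)))
                - (\<Sum>i=0..n. (-1) ^ i * of_nat (n choose i) * f (Suc i))"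
    by (simp only: sum_subtractf add_diff_eq)
  \<comment> \<open>The sum may be extended to \<open>Suc n\<close> and shifted because \<open>n choose Suc n\<close> vanishes.\<close>
  also have "f 0 + (\<Sum>i=0..n. ?t (Suc i)) = (\<Sum>i=0..Suc n. ?t i)"
    by (subst sum.atLeast0_atMost_Suc_shift) simp
  also have "\<dots> = (\<Sum>i=0..n. ?t i)"
    by (simp add: binomial_eq_0)
  finally show ?thesis
    by (simp add: sum_subtractf right_diff_distrib)
qed

theorem theorem4p2:
  fixes a :: "nat \<Rightarrow> real"
  assumes pos: "\<And>n. 0 < a n"
    and nondecreasing: "mono a"
  shows "log_completely_alternating a \<longleftrightarrow>
         log_completely_alternating (\<lambda>n. a n / a (Suc n))"
proof -
  let ?D = "\<lambda>c n k. \<Sum>i=0..n. (-1) ^ i * real (n choose i) * ln (c (k + i))"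
  let ?b = "\<lambda>n. a n / a (Suc n)"
  have quotient: "?D ?b n k = ?D a (Suc n) k" for n k
    using alternating_binomial_sum_Suc[of n "\<lambda>i. ln (a (k + i))"] pos
    by (simp add: ln_divide_pos)
  have order_one: "?D a 1 k \<le> 0" for k
    using pos monoD[OF nondecreasing, of k "Suc k"] by simp
  have "(\<forall>n\<ge>1. \<forall>k. ?D a n k \<le> 0) \<longleftrightarrow> (\<forall>n\<ge>1. \<forall>k. ?D a (Suc n) k \<le> 0)"
  proof (intro iffI allI impI)
    fix n k :: nat
    assume higher: "\<forall>n\<ge>1. \<forall>k. ?D a (Suc n) k \<le> 0" and "1 \<le> n"
    then consider "n = 1" | m where "n = Suc m" "1 \<le> m"
      by (cases n) fastforce+
    then show "?D a n k \<le> 0"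
      using order_one higher by cases blast+
  qed (meson le_SucI)
  then show ?thesis
    unfolding log_completely_alternating_def quotient using pos by simp
qed

end
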